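(* Let $G=(V,E)$ be a graph containing exactly $k$ triangles, and let $m$ denote the number of vertices of $G$ that do not lie on any triangle. Then the $\Delta$-Helly number satisfies $h_\Delta(G)\leq m+2k$.
   Context: All graphs are finite, simple, undirected and connected. A triangle is a set of three pairwise adjacent vertices (a copy of $K_3$). For $S\subseteq V$, the $\Delta$-interval $[S]$ is the set consisting of all vertices of $S$ together with every vertex $v\in V$ that is adjacent to both $x$ and $y$ for some pair of adjacent vertices $x,y\in S$. A set $S$ is $\Delta$-convex if $[S]=S$. The $\Delta$-convex hull $\langle S\rangle$ is the smallest $\Delta$-convex set containing $S$ (note $\langle\emptyset\rangle=\emptyset$). A set $S\subseteq V$ is Helly dependent if $\bigcap_{a\in S}\langle S\setminus\{a\}\rangle\neq\emptyset$, and Helly independent otherwise. The Helly number $h_\Delta(G)$ is the least integer $n\ge 0$ such that every $S\subseteq V$ with $|S|>n$ is Helly dependent (equivalently, the maximum size of a Helly independent set). *)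

theory Defs
  imports Main "Graph_Theory.Digraph_Component"
begin

text \<open>
  Undirected graphs are those of the locale \<^locale>\<open>graph\<close>: finite, loop-free, symmetric digraphs
  without parallel arcs. The relation \<open>u \<rightarrow>\<^bsub>G\<^esub> v\<close> is adjacency.
\<close>

definition triangles :: "('a, 'b) pre_digraph \<Rightarrow> 'a set set" where
  "triangles G = {T. T \<subseteq> verts G \<and> card T = 3 \<and> (\<forall>x\<in>T. \<forall>y\<in>T. x \<noteq> y \<longrightarrow> x \<rightarrow>\<^bsub>G\<^esub> y)}"

definition delta_interval :: "('a, 'b) pre_digraph \<Rightarrow> 'a set \<Rightarrow> 'a set" where
  "delta_interval G S =
     S \<union> {v \<in> verts G. \<exists>x\<in>S. \<exists>y\<in>S. x \<rightarrow>\<^bsub>G\<^esub> y \<and> v \<rightarrow>\<^bsub>G\<^esub> x \<and> v \<rightarrow>\<^bsub>G\<^esub> y}"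

definition delta_convex :: "('a, 'b) pre_digraph \<Rightarrow> 'a set \<Rightarrow> bool" where
  "delta_convex G S \<longleftrightarrow> S \<subseteq> verts G \<and> delta_interval G S = S"

definition delta_hull :: "('a, 'b) pre_digraph \<Rightarrow> 'a set \<Rightarrow> 'a set" where
  "delta_hull G S = delta_convex G hull S"

text \<open>
  For \<open>S = {}\<close> the intersection below is \<^const>\<open>UNIV\<close>, so \<open>{}\<close> counts as dependent. This does
  not affect the Helly number, which only tests sets \<open>S\<close> with \<open>card S > n \<ge> 0\<close>.
\<close>

definition helly_dependent :: "('a, 'b) pre_digraph \<Rightarrow> 'a set \<Rightarrow> bool" where
  "helly_dependent G S \<longleftrightarrow> (\<Inter>a\<in>S. delta_hull G (S - {a})) \<noteq> {}"

definition helly_number :: "('a, 'b) pre_digraph \<Rightarrow> nat" where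
  "helly_number G = (LEAST n. \<forall>S. S \<subseteq> verts G \<and> card S > n \<longrightarrow> helly_dependent G S)"

text \<open>On sets of vertices the hull is the least convex superset, and the minimum defining the
  Helly number is attained.\<close>

lemma delta_convex_delta_hull:
  assumes "S \<subseteq> verts G"
  shows "delta_convex G (delta_hull G S)"
proof -
  have V: "delta_convex G (verts G)"
    by (auto simp: delta_convex_def delta_interval_def)
  then have sub: "delta_hull G S \<subseteq> verts G"
    using assms unfolding delta_hull_def by (rule hull_minimal[rotated])
  have "delta_interval G (delta_hull G S) \<subseteq> C" if C: "delta_convex G C" "S \<subseteq> C" for C
  proof -
    have "delta_hull G S \<subseteq> C"
      using C unfolding delta_hull_def by (simp add: hull_minimal)
    then have "delta_interval G (delta_hull G S) \<subseteq> delta_interval G C"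
      unfolding delta_interval_def by blast
    then show ?thesis using C by (simp add: delta_convex_def)
  qed
  then have "delta_interval G (delta_hull G S) \<subseteq> delta_hull G S"
    by (subst (2) delta_hull_def) (auto simp: hull_def)
  then show ?thesis
    using sub by (auto simp: delta_convex_def delta_interval_def)
qed

lemma delta_hull_superset: "S \<subseteq> delta_hull G S"
  unfolding delta_hull_def by (rule hull_subset)

lemma delta_hull_least: "S \<subseteq> C \<Longrightarrow> delta_convex G C \<Longrightarrow> delta_hull G S \<subseteq> C"
  unfolding delta_hull_def by (rule hull_minimal)

lemma helly_number_attained:
  assumes "finite (verts G)" "S \<subseteq> verts G" "card S > helly_number G"
  shows "helly_dependent G S"
proof -
  have "\<forall>S. S \<subseteq> verts G \<and> card S > card (verts G) \<longrightarrow> helly_dependent G S"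
    using assms(1) by (meson card_mono not_le)
  then have "\<forall>S. S \<subseteq> verts G \<and> card S > helly_number G \<longrightarrow> helly_dependent G S"
    unfolding helly_number_def by (rule LeastI)
  then show ?thesis using assms by blast
qed

end

theory Submission
  imports Defs
begin

text \<open>
  A set containing a whole triangle \<open>{a, b, c}\<close> is Helly dependent: deleting one vertex still
  leaves two adjacent vertices of the triangle, which regenerate the third. A set of more than
  \<open>m + 2 * k\<close> vertices has more than \<open>2 * k\<close> vertices on triangles, so by pigeonhole it contains
  all three vertices of some triangle.
\<close>

text \<open>The two vertices of \<open>T - {a}\<close> form an edge inside the hull with
  \<open>a\<close> as a common neighbour, and a convex hull is closed under
  \<open>delta_interval\<close>. Applied below with \<open>S - {a}\<close> in place of
  \<open>S\<close>.\<close>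

lemma delta_hull_triangle:
  assumes "S \<subseteq> verts G" and T: "T \<in> triangles G" and "a \<in> T" and "T - {a} \<subseteq> S"
  shows "a \<in> delta_hull G S"
proof -
  let ?H = "delta_hull G S"
  have "card (T - {a}) = 2"
    using T \<open>a \<in> T\<close> by (simp add: triangles_def card_Diff_singleton)
  then obtain b c where bc: "T - {a} = {b, c}" "b \<noteq> c"
    by (auto simp: card_2_iff)
  have "b \<in> T" "c \<in> T" "a \<noteq> b" "a \<noteq> c"
    using bc by auto
  then have "b \<rightarrow>\<^bsub>G\<^esub> c" "a \<rightarrow>\<^bsub>G\<^esub> b" "a \<rightarrow>\<^bsub>G\<^esub> c" "a \<in> verts G"
    using T \<open>a \<in> T\<close> bc(2) by (auto simp: triangles_def)
  moreover have "b \<in> ?H" "c \<in> ?H"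
    using assms(4) bc(1) delta_hull_superset[of S G] by auto
  ultimately have "a \<in> delta_interval G ?H"
    unfolding delta_interval_def by blast
  then show ?thesis
    using delta_convex_delta_hull[OF \<open>S \<subseteq> verts G\<close>] by (simp add: delta_convex_def)
qed

lemma helly_dependent_if_triangle_subset:
  assumes S: "S \<subseteq> verts G" and T: "T \<in> triangles G" and "T \<subseteq> S"
  shows "helly_dependent G S"
proof -
  have "T \<noteq> {}"
    using T by (auto simp: triangles_def)
  then obtain a where a: "a \<in> T" by blast
  \<comment> \<open>One fixed vertex \<open>a\<close> of the triangle witnesses the whole
    intersection: it survives every deletion except its own, and then the rest of \<open>T\<close>
    regenerates it.\<close>
  have "a \<in> delta_hull G (S - {x})" for x
  proof (cases "x = a")
    case True
    then show ?thesis
      using S T a \<open>T \<subseteq> S\<close> by (intro delta_hull_triangle[of _ _ T]) auto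
  next
    case False
    then show ?thesis
      using a \<open>T \<subseteq> S\<close> delta_hull_superset[of "S - {x}" G] by auto
  qed
  then show ?thesis
    unfolding helly_dependent_def by blast
qed

lemma card_triangle_free_le:
  assumes "finite (verts G)" and S: "S \<subseteq> verts G"
    and free: "\<And>T. T \<in> triangles G \<Longrightarrow> \<not> T \<subseteq> S"
  shows "card S \<le> card {v \<in> verts G. \<forall>T \<in> triangles G. v \<notin> T} + 2 * card (triangles G)"
proof -
  let ?M = "{v \<in> verts G. \<forall>T \<in> triangles G. v \<notin> T}"
  have fin: "finite (triangles G)"
    by (rule finite_subset[of _ "Pow (verts G)"]) (use assms(1) in \<open>auto simp: triangles_def\<close>)
  have le2: "card (S \<inter> T) \<le> 2" if T: "T \<in> triangles G" for T
  proof -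
    have "card T = 3" "finite T"
      using T by (auto simp: triangles_def intro: card_ge_0_finite)
    \<comment> \<open>Triangle-freeness enters here: the trace of \<open>S\<close> on
      \<open>T\<close> is proper, so it has fewer than 3 elements.\<close>
    moreover have "S \<inter> T \<subset> T"
      using free[OF T] by blast
    ultimately show ?thesis
      using psubset_card_mono[of T "S \<inter> T"] by simp
  qed
  have finS: "finite S"
    using assms(1) S finite_subset by blast
  \<comment> \<open>A vertex of \<open>S\<close> outside \<open>?M\<close> lies on some triangle,
    hence in one of the traces \<open>S \<inter> T\<close>. Triangles may share vertices, so the
    traces are only bounded by a sum.\<close>
  have "card S \<le> card (?M \<union> (\<Union>T\<in>triangles G. S \<inter> T))"
    using assms(1) fin finS S by (intro card_mono) auto
  also have "\<dots> \<le> card ?M + card (\<Union>T\<in>triangles G. S \<inter> T)"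
    by (rule card_Un_le)
  also have "card (\<Union>T\<in>triangles G. S \<inter> T) \<le> (\<Sum>T\<in>triangles G. card (S \<inter> T))"
    by (rule card_UN_le[OF fin])
  also have "\<dots> \<le> 2 * card (triangles G)"
    using sum_bounded_above[of "triangles G" "\<lambda>T. card (S \<inter> T)" 2] le2 by simp
  finally show ?thesis by simp
qed

theorem theorem2:
  fixes G :: "('a, 'b) pre_digraph" and k m :: nat
  assumes "graph G" and "connected G"
    and "card (triangles G) = k"
    and "card {v \<in> verts G. \<forall>T \<in> triangles G. v \<notin> T} = m"
  shows "helly_number G \<le> m + 2 * k"
proof -
  interpret graph G by fact
  have "helly_dependent G S" if S: "S \<subseteq> verts G" "card S > m + 2 * k" for S
  proof -
    \<comment> \<open>The counting bound is used in contrapositive form: a set this large cannot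
      avoid containing a triangle.\<close>
    obtain T where "T \<in> triangles G" "T \<subseteq> S"
      using card_triangle_free_le[OF finite_verts S(1)] S(2) assms(3,4) by fastforce
    then show ?thesis
      using helly_dependent_if_triangle_subset S(1) by blast
  qed
  then show ?thesis
    unfolding helly_number_def by (intro Least_le) blast
qed

end
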